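(* Let $k \ge 2$. Then $$d_k(P_2 \boxtimes P_n) = \begin{cases} 3, & \text{if } 2 \le n \le 3,\\ 4, & \text{if } 4 \le n \le k+1.\end{cases}$$
   Context: $P_n$ is the path on $n$ vertices. $P_m \boxtimes P_n$ is the strong product (strong grid): vertices $(i,j)$, $0\le i\le m-1$, $0\le j\le n-1$, with distinct $(i,j)$, $(i',j')$ adjacent iff $|i-i'|\le 1$ and $|j-j'|\le 1$. The $k$-move deduction game ($k$ a positive integer) on a finite graph $G$: a layout places a finite number of searchers on vertices of $G$ (several searchers may share a vertex). Every searcher is initially mobile. A vertex is protected once it has been occupied by some searcher (so initially occupied vertices are protected); other vertices are unprotected. The game proceeds in stages. At each stage, for every vertex $v$ that has at least one unprotected neighbour: if the number of mobile searchers on $v$ is at least the number of unprotected neighbours of $v$, then the mobile searchers on $v$ move to the unprotected neighbours of $v$ so that each unprotected neighbour receives at least one searcher; excess mobile searchers on $v$ may also move to any of these unprotected neighbours. All moves in a stage happen simultaneously, newly occupied vertices become protected, and a searcher that has moved $k$ times becomes immobile. The process repeats until all vertices are protected or no searcher can move. A layout is successful if all vertices of $G$ end up protected. The $k$-move deduction number $d_k(G)$ is the minimum number of searchers in a successful layout on $G$. *)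

theory Defs
  imports "Graph_Theory.Pair_Digraph"
begin

section \<open>Paths and strong products\<close>

text \<open>A finite simple graph is a loop-free symmetric finite pair digraph (locale \<open>pair_graph\<close>),
  each edge being represented by its two arcs.\<close>

definition path_graph :: "nat \<Rightarrow> nat pair_pre_digraph" where
  "path_graph n =
     \<lparr> pverts = {..<n},
       parcs = {(i, j). i < n \<and> j < n \<and> (j = Suc i \<or> i = Suc j)} \<rparr>"

definition strong_product ::
    "'a pair_pre_digraph \<Rightarrow> 'b pair_pre_digraph \<Rightarrow> ('a \<times> 'b) pair_pre_digraph"
    (infixr "\<boxtimes>" 70) where
  "G \<boxtimes> H =
     \<lparr> pverts = pverts G \<times> pverts H,
       parcs = {(x, y). x \<in> pverts G \<times> pverts H \<and> y \<in> pverts G \<times> pverts H \<and> x \<noteq> y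
                 \<and> (fst x = fst y \<or> (fst x, fst y) \<in> parcs G)
                 \<and> (snd x = snd y \<or> (snd x, snd y) \<in> parcs H)} \<rparr>"

lemma pverts_strong_grid:
  "pverts (path_graph m \<boxtimes> path_graph n) = {..<m} \<times> {..<n}"
  by (simp add: path_graph_def strong_product_def)

lemma parcs_strong_grid:
  "((i, j), (i', j')) \<in> parcs (path_graph m \<boxtimes> path_graph n) \<longleftrightarrow>
     i < m \<and> j < n \<and> i' < m \<and> j' < n \<and> (i, j) \<noteq> (i', j')
     \<and> \<bar>int i - int i'\<bar> \<le> 1 \<and> \<bar>int j - int j'\<bar> \<le> 1"
  by (auto simp: path_graph_def strong_product_def)

lemma pair_graph_strong_grid: "pair_graph (path_graph m \<boxtimes> path_graph n)"
proof -
  let ?G = "path_graph m \<boxtimes> path_graph n"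
  have arcs: "parcs ?G \<subseteq> pverts ?G \<times> pverts ?G"
    by (auto simp: strong_product_def)
  have fin: "finite (pverts ?G)"
    by (simp add: pverts_strong_grid)
  have "finite (parcs ?G)"
    by (rule finite_subset[OF arcs]) (simp add: fin)
  moreover have "sym (parcs ?G)"
    by (auto simp: sym_def path_graph_def strong_product_def)
  hence "symmetric (with_proj ?G)"
    by (simp add: symmetric_def)
  moreover have "fst e \<noteq> snd e" if "e \<in> parcs ?G" for e
    using that by (auto simp: strong_product_def)
  ultimately show ?thesis
    using fin arcs by unfold_locales auto
qed

section \<open>The deduction game\<close>

text \<open>The \<open>s\<close> searchers are numbered \<open>0, \<dots>, s - 1\<close>; the values of \<open>pos\<close> and
  \<open>moves\<close> (the number of moves made so far) at other arguments are irrelevant.\<close>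

record 'a config =
  pos :: "nat \<Rightarrow> 'a"
  moves :: "nat \<Rightarrow> nat"
  protected :: "'a set"

definition initial_config :: "nat \<Rightarrow> (nat \<Rightarrow> 'a) \<Rightarrow> 'a config" where
  "initial_config s L = \<lparr> pos = L, moves = (\<lambda>_. 0), protected = L ` {..<s} \<rparr>"

definition unprotected_nbrs :: "'a pair_pre_digraph \<Rightarrow> 'a config \<Rightarrow> 'a \<Rightarrow> 'a set" where
  "unprotected_nbrs G c v = {u. (v, u) \<in> parcs G \<and> u \<notin> protected c}"

definition mobile :: "nat \<Rightarrow> nat \<Rightarrow> 'a config \<Rightarrow> 'a \<Rightarrow> nat set" where
  "mobile k s c v = {i. i < s \<and> pos c i = v \<and> moves c i < k}"

definition fires :: "nat \<Rightarrow> nat \<Rightarrow> 'a pair_pre_digraph \<Rightarrow> 'a config \<Rightarrow> 'a \<Rightarrow> bool" where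
  "fires k s G c v \<longleftrightarrow>
     v \<in> pverts G \<and> unprotected_nbrs G c v \<noteq> {}
     \<and> card (unprotected_nbrs G c v) \<le> card (mobile k s c v)"

text \<open>\<open>stage k s G c d\<close>: one stage of the game can lead from \<open>c\<close> to \<open>d\<close>. It is a relation
  because the searchers choose their targets and because excess searchers may either stay
  or move. When no vertex fires, only the trivial stage remains.\<close>

definition stage ::
    "nat \<Rightarrow> nat \<Rightarrow> 'a pair_pre_digraph \<Rightarrow> 'a config \<Rightarrow> 'a config \<Rightarrow> bool" where
  "stage k s G c d \<longleftrightarrow>
     (\<forall>v. fires k s G c v \<longrightarrow>
        (\<forall>u\<in>unprotected_nbrs G c v. \<exists>i\<in>mobile k s c v. pos d i = u)) \<and>
     (\<forall>i<s. pos d i \<noteq> pos c i \<longrightarrow>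
        fires k s G c (pos c i) \<and> i \<in> mobile k s c (pos c i)
        \<and> pos d i \<in> unprotected_nbrs G c (pos c i)) \<and>
     (\<forall>i<s. moves d i = (if pos d i = pos c i then moves c i else Suc (moves c i))) \<and>
     protected d = protected c \<union> pos d ` {..<s}"

definition is_layout :: "'a pair_pre_digraph \<Rightarrow> nat \<Rightarrow> (nat \<Rightarrow> 'a) \<Rightarrow> bool" where
  "is_layout G s L \<longleftrightarrow> L ` {..<s} \<subseteq> pverts G"

text \<open>Protected vertices stay protected, and once all vertices are protected no vertex fires.
  So the game ends with all vertices protected iff such a configuration is reached. The choices
  in a stage are the searchers': one suitable sequence of choices suffices.\<close>

definition successful_layout ::
    "nat \<Rightarrow> 'a pair_pre_digraph \<Rightarrow> nat \<Rightarrow> (nat \<Rightarrow> 'a) \<Rightarrow> bool" where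
  "successful_layout k G s L \<longleftrightarrow>
     is_layout G s L \<and>
     (\<exists>d. (stage k s G)\<^sup>*\<^sup>* (initial_config s L) d \<and> pverts G \<subseteq> protected d)"

definition deduction_number :: "nat \<Rightarrow> 'a pair_pre_digraph \<Rightarrow> nat" where
  "deduction_number k G = (LEAST s. \<exists>L. successful_layout k G s L)"

text \<open>The minimum exists: on a finite graph, one searcher per vertex is a successful layout.\<close>

lemma successful_layout_exists:
  assumes "finite (pverts G)"
  shows "\<exists>s L. successful_layout k G s L"
proof -
  obtain L where L: "bij_betw L {..<card (pverts G)} (pverts G)"
    using ex_bij_betw_nat_finite[OF assms] by (auto simp: atLeast0LessThan)
  hence "L ` {..<card (pverts G)} = pverts G"
    by (simp add: bij_betw_def)
  hence "successful_layout k G (card (pverts G)) L"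
    unfolding successful_layout_def is_layout_def
    by (intro conjI exI[of _ "initial_config (card (pverts G)) L"])
      (auto simp: initial_config_def)
  thus ?thesis by blast
qed

lemma deduction_number_attained:
  assumes "finite (pverts G)"
  shows "\<exists>L. successful_layout k G (deduction_number k G) L"
  unfolding deduction_number_def
  using successful_layout_exists[OF assms] by (rule LeastI_ex)

end

theory Submission
  imports Defs
begin

text \<open>Lower bounds: before anything has moved, a vertex \<open>v\<close> carrying \<open>m\<close> searchers has at most
  \<open>s - m\<close> protected neighbours, so it can only fire if its degree is at most \<open>s\<close>. As all degrees
  are at least 3, two searchers never move. Three searchers can only start from a corner, with the
  other searchers next to it. After that stage, exactly the first two columns are protected and both
  vertices of the second column are occupied, so the next column is reached by a single pair and the
  third searcher stays behind; then the two searchers of the pair are alone on their vertices and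
  face two unprotected vertices each.

  Upper bounds: four searchers, two on each vertex of the first column, sweep the grid. For
  \<open>n = 3\<close>, one searcher on each of three vertices of the first two columns suffices, since the two
  corner searchers move to the fourth vertex together and separate from there.\<close>

section \<open>Stages of the game\<close>

lemma stageI:
  assumes "\<And>v u. fires k s G c v \<Longrightarrow> u \<in> unprotected_nbrs G c v \<Longrightarrow> \<exists>i\<in>mobile k s c v. p i = u"
    and "\<And>i. i < s \<Longrightarrow> p i \<noteq> pos c i \<Longrightarrow> fires k s G c (pos c i) \<and> moves c i < k
           \<and> p i \<in> unprotected_nbrs G c (pos c i)"
    and "\<And>i. i < s \<Longrightarrow> m i = (if p i = pos c i then moves c i else Suc (moves c i))"
    and "P = protected c \<union> p ` {..<s}"
  shows "stage k s G c \<lparr>pos = p, moves = m, protected = P\<rparr>"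
  using assms unfolding stage_def by (auto simp: mobile_def)

lemma stage_movedD:
  assumes "stage k s G c d" "i < s" "pos d i \<noteq> pos c i"
  shows "fires k s G c (pos c i)" "i \<in> mobile k s c (pos c i)"
    "pos d i \<in> unprotected_nbrs G c (pos c i)"
  using assms unfolding stage_def by blast+

lemma stage_firesD:
  assumes "stage k s G c d" "fires k s G c v" "u \<in> unprotected_nbrs G c v"
  obtains i where "i \<in> mobile k s c v" "pos d i = u"
  using assms unfolding stage_def by blast

lemma stage_protected:
  assumes "stage k s G c d"
  shows "protected d = protected c \<union> pos d ` {..<s}"
  using assms unfolding stage_def by blast

text \<open>A searcher leaves only a vertex that fires, so just the trivial stage remains. The
  positions are joined to \<open>protected\<close> because an arbitrary record may have searchers on
  unprotected vertices.\<close>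

lemma stage_no_fires:
  assumes "stage k s G c d" "\<And>v. \<not> fires k s G c v"
  shows "\<And>i. i < s \<Longrightarrow> pos d i = pos c i" "protected d = protected c \<union> pos c ` {..<s}"
proof -
  show eq: "pos d i = pos c i" if "i < s" for i
    using stage_movedD(1)[OF assms(1) that] assms(2) by blast
  show "protected d = protected c \<union> pos c ` {..<s}"
    using eq stage_protected[OF assms(1)] by auto
qed

lemma finite_mobile: "finite (mobile k s c v)"
  by (rule finite_subset[of _ "{..<s}"]) (auto simp: mobile_def)

lemma mobileD:
  assumes "i \<in> mobile k s c v"
  shows "i < s" "pos c i = v"
  using assms by (auto simp: mobile_def)

text \<open>Finiteness excludes an infinite neighbour set, whose \<open>card\<close> is 0, so that
  its vertex would fire without searchers.\<close>

lemma fires_mobile: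
  assumes "fires k s G c v" "finite (unprotected_nbrs G c v)"
  obtains i where "i \<in> mobile k s c v"
proof -
  have "card (mobile k s c v) > 0"
    using assms unfolding fires_def by (metis card_gt_0_iff less_le_trans)
  thus ?thesis
    using that by (auto simp: card_gt_0_iff)
qed

lemma unprotected_nbrs_subset: "unprotected_nbrs G c v \<subseteq> parcs G `` {v}"
  by (auto simp: unprotected_nbrs_def)

text \<open>By \<open>prot\<close> only occupied vertices are protected, as before any move. A
  neighbour of \<open>v\<close> is then either unprotected, and the mobile searchers on
  \<open>v\<close> are at least as many as these, or occupied by one of the remaining searchers. If
  \<open>s\<close> is at most the degree, the count is tight and the remaining searchers sit on
  distinct neighbours.\<close>

lemma first_fire:
  assumes fin: "finite (parcs G `` {v})" and "(v, v) \<notin> parcs G"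
    and prot: "protected c = pos c ` {..<s}" and fires: "fires k s G c v"
  shows "card (parcs G `` {v}) \<le> s"
    and "s \<le> card (parcs G `` {v}) \<Longrightarrow> pos c ` {..<s} \<subseteq> insert v (parcs G `` {v})"
proof -
  let ?N = "parcs G `` {v}" and ?M = "mobile k s c v"
  let ?R = "{..<s} - ?M"
  have M: "?M \<subseteq> {..<s}"
    by (auto simp: mobile_def)
  have "?N \<subseteq> unprotected_nbrs G c v \<union> (?N \<inter> pos c ` ?R)"
    using assms(2) prot by (auto simp: unprotected_nbrs_def mobile_def)
  hence "card ?N \<le> card (unprotected_nbrs G c v \<union> (?N \<inter> pos c ` ?R))"
    using fin finite_subset[OF unprotected_nbrs_subset fin] by (intro card_mono) auto
  also have "\<dots> \<le> card (unprotected_nbrs G c v) + card (?N \<inter> pos c ` ?R)"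
    by (rule card_Un_le)
  also have "card (unprotected_nbrs G c v) \<le> card ?M"
    using fires by (simp add: fires_def)
  finally have N: "card ?N \<le> card ?M + card (?N \<inter> pos c ` ?R)"
    by simp
  have R: "card ?M + card ?R = s"
    using card_Diff_subset[OF finite_mobile M] card_mono[OF _ M] by simp
  have img: "card (pos c ` ?R) \<le> card ?R"
    by (rule card_image_le) simp
  have "card (?N \<inter> pos c ` ?R) \<le> card (pos c ` ?R)"
    by (rule card_mono) auto
  with N R img show "card ?N \<le> s"
    by linarith
  assume "s \<le> card ?N"
  with N R img have "card (pos c ` ?R) \<le> card (?N \<inter> pos c ` ?R)"
    by linarith
  hence "?N \<inter> pos c ` ?R = pos c ` ?R"
    by (intro card_seteq) auto
  moreover have "pos c i = v" if "i \<in> ?M" for i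
    using that by (rule mobileD)
  ultimately show "pos c ` {..<s} \<subseteq> insert v ?N"
    by blast
qed

section \<open>Strips of width two\<close>

text \<open>The level of a vertex is its column, counted from either end, so that the
  two ends of the grid need not be treated separately.\<close>

locale strip =
  fixes G :: "'a pair_pre_digraph" and lev :: "'a \<Rightarrow> nat" and n :: nat
  assumes arc_iff: "(u, v) \<in> parcs G \<longleftrightarrow> u \<in> pverts G \<and> v \<in> pverts G \<and> u \<noteq> v
      \<and> lev u \<le> Suc (lev v) \<and> lev v \<le> Suc (lev u)"
    and lev_less: "v \<in> pverts G \<Longrightarrow> lev v < n"
    and card_level: "j < n \<Longrightarrow> card {v \<in> pverts G. lev v = j} = 2"
begin

definition level :: "nat \<Rightarrow> 'a set" where
  "level j = {v \<in> pverts G. lev v = j}"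

text \<open>Finiteness comes from the cardinalities: a set with \<open>card\<close> equal to 2 is
  finite, and levels from \<open>n\<close> on are empty.\<close>

lemma finite_level: "finite (level j)"
proof (cases "j < n")
  case True
  thus ?thesis
    using card_level unfolding level_def by (intro card_ge_0_finite) simp
next
  case False
  hence "level j = {}"
    using lev_less by (auto simp: level_def)
  thus ?thesis by simp
qed

lemma finite_pverts: "finite (pverts G)"
proof (rule finite_subset)
  show "pverts G \<subseteq> (\<Union>j<n. level j)"
    using lev_less by (auto simp: level_def)
qed (simp add: finite_level)

lemma finite_nbrs: "finite (parcs G `` {v})"
  by (rule finite_subset[OF _ finite_pverts]) (auto simp: arc_iff)

section \<open>Counting vertices and degrees by levels\<close>

lemma card_levels:
  assumes "finite A" "A \<subseteq> {..<n}"
  shows "card (\<Union>j\<in>A. level j) = 2 * card A"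
proof -
  have "card (\<Union>j\<in>A. level j) = (\<Sum>j\<in>A. card (level j))"
    using assms finite_level by (intro card_UN_disjoint) (auto simp: level_def)
  also have "\<dots> = (\<Sum>j\<in>A. 2)"
    using assms card_level by (intro sum.cong) (auto simp: level_def)
  finally show ?thesis by simp
qed

lemma card_pverts: "card (pverts G) = 2 * n"
proof -
  have "(\<Union>j<n. level j) = pverts G"
    using lev_less by (auto simp: level_def)
  thus ?thesis
    using card_levels[of "{..<n}"] by simp
qed

text \<open>Levels at distance at most one from that of \<open>v\<close> lie in its closed
  neighbourhood and contribute two vertices each; \<open>Suc\<close> accounts for \<open>v\<close>
  itself.\<close>

lemma degree_ge:
  assumes "v \<in> pverts G" "finite A" "A \<subseteq> {..<n}" "\<And>j. j \<in> A \<Longrightarrow> j \<le> Suc (lev v) \<and> lev v \<le> Suc j"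
  shows "2 * card A \<le> Suc (card (parcs G `` {v}))"
proof -
  have "(\<Union>j\<in>A. level j) \<subseteq> insert v (parcs G `` {v})"
    using assms(1,4) by (auto simp: level_def arc_iff)
  hence "card (\<Union>j\<in>A. level j) \<le> card (insert v (parcs G `` {v}))"
    using finite_nbrs by (intro card_mono) auto
  also have "\<dots> \<le> Suc (card (parcs G `` {v}))"
    by (rule card_insert_le_m1) auto
  finally show ?thesis
    using card_levels assms(2,3) by simp
qed

lemma degree_ge_3:
  assumes "v \<in> pverts G" "2 \<le> n"
  shows "3 \<le> card (parcs G `` {v})"
proof (cases "Suc (lev v) < n")
  case True
  hence "2 * card {lev v, Suc (lev v)} \<le> Suc (card (parcs G `` {v}))"
    by (intro degree_ge[OF assms(1)]) auto
  thus ?thesis by simp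
next
  case False
  \<comment> \<open>Here \<open>v\<close> is on the last level, and \<open>2 \<le> n\<close>
    provides the level before it.\<close>
  with assms lev_less[OF assms(1)] obtain j where "lev v = Suc j" "Suc j < n"
    by (cases "lev v") auto
  hence "2 * card {j, Suc j} \<le> Suc (card (parcs G `` {v}))"
    by (intro degree_ge[OF assms(1)]) auto
  thus ?thesis by simp
qed

text \<open>Three levels give at least five neighbours, too many for three searchers to fire an
  inner vertex at the start.\<close>

lemma degree_gt_3:
  assumes "v \<in> pverts G" "0 < lev v" "Suc (lev v) < n"
  shows "3 < card (parcs G `` {v})"
proof -
  obtain j where "lev v = Suc j"
    using assms(2) by (cases "lev v") auto
  hence "2 * card {j, Suc j, Suc (Suc j)} \<le> Suc (card (parcs G `` {v}))"
    using assms(3) by (intro degree_ge[OF assms(1)]) auto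
  thus ?thesis by simp
qed

lemma initial_fires_degree:
  assumes "protected c = pos c ` {..<s}" "fires k s G c v"
  shows "v \<in> pverts G" "card (parcs G `` {v}) \<le> s"
    "s \<le> card (parcs G `` {v}) \<Longrightarrow> pos c ` {..<s} \<subseteq> insert v (parcs G `` {v})"
proof -
  have "(v, v) \<notin> parcs G"
    by (simp add: arc_iff)
  note first_fire[OF finite_nbrs this assms]
  thus "card (parcs G `` {v}) \<le> s"
    "s \<le> card (parcs G `` {v}) \<Longrightarrow> pos c ` {..<s} \<subseteq> insert v (parcs G `` {v})"
    by blast+
  show "v \<in> pverts G"
    using assms(2) by (simp add: fires_def)
qed

lemma card_initial:
  assumes "protected c = pos c ` {..<s}" "s < 2 * n"
  shows "\<not> pverts G \<subseteq> protected c"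
proof
  assume "pverts G \<subseteq> protected c"
  hence "card (pverts G) \<le> card (pos c ` {..<s})"
    using assms(1) by (intro card_mono) auto
  also have "\<dots> \<le> s"
    using card_image_le[of "{..<s}" "pos c"] by simp
  finally show False
    using assms(2) card_pverts by simp
qed

section \<open>Games in which an initial block of levels is protected\<close>

text \<open>The second conjunct confines the searchers to the protected levels, so that a stage
  without firing protects nothing new.\<close>

definition covered :: "nat \<Rightarrow> nat \<Rightarrow> 'a config \<Rightarrow> bool" where
  "covered s l c \<longleftrightarrow> protected c = (\<Union>j\<le>l. level j) \<and> pos c ` {..<s} \<subseteq> protected c"

lemma covered_unprotected_nbrs:
  assumes "covered s l c" "v \<in> level l"
  shows "unprotected_nbrs G c v = level (Suc l)"
  using assms unfolding covered_def by (auto simp: level_def unprotected_nbrs_def arc_iff)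

text \<open>Only level \<open>l\<close> borders on unprotected vertices, and each of its vertices is
  adjacent to both vertices of the next level.\<close>

lemma covered_fires:
  assumes c: "covered s l c" and fires: "fires k s G c v" and "Suc l < n"
  shows "v \<in> level l" "2 \<le> card (mobile k s c v)"
proof -
  obtain i where "i \<in> mobile k s c v"
    using fires_mobile[OF fires finite_subset[OF unprotected_nbrs_subset finite_nbrs]] .
  hence "v \<in> protected c"
    using c by (auto simp: covered_def mobile_def)
  moreover obtain u where "(v, u) \<in> parcs G" "u \<notin> protected c"
    using fires by (auto simp: fires_def unprotected_nbrs_def)
  ultimately show v: "v \<in> level l"
    using c by (auto simp: covered_def level_def arc_iff)
  have "card (level (Suc l)) = 2"
    using card_level[OF assms(3)] by (simp add: level_def)
  thus "2 \<le> card (mobile k s c v)"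
    using fires covered_unprotected_nbrs[OF c v] by (simp add: fires_def)
qed

lemma covered_stage_no_fires:
  assumes "covered s l c" "stage k s G c d" "\<And>v. \<not> fires k s G c v"
  shows "covered s l d" "\<And>i. i < s \<Longrightarrow> pos d i = pos c i"
  using stage_no_fires[OF assms(2,3)] assms(1) by (auto simp: covered_def)

text \<open>The state after the first firing with at most three searchers. As both vertices of level
  1 are occupied, at most two searchers can share one of them.\<close>

definition both_occupied :: "nat \<Rightarrow> 'a config \<Rightarrow> bool" where
  "both_occupied s c \<longleftrightarrow> covered s 1 c \<and> level 1 \<subseteq> pos c ` {..<s}"

text \<open>The deadlock: advancing to level 3 takes two searchers on one vertex of level 2, and
  injectivity allows only one.\<close>

definition singly_occupied :: "nat \<Rightarrow> 'a config \<Rightarrow> bool" where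
  "singly_occupied s c \<longleftrightarrow> covered s 2 c \<and> inj_on (pos c) {i. i < s \<and> pos c i \<in> level 2}"

text \<open>The searchers start on the first two levels. Those on level 1 stay, since level 1 cannot
  fire, and the firing of \<open>v\<close> fills whatever is still unprotected there.\<close>

lemma initial_stage:
  assumes c: "protected c = pos c ` {..<s}" and st: "stage k s G c d"
    and v: "fires k s G c v" "lev v = 0" and "s \<le> 3" "3 \<le> n"
  shows "both_occupied s d"
proof -
  have v_vert: "v \<in> pverts G"
    using v(1) by (simp add: fires_def)
  \<comment> \<open>This is the tight case of the count, so all searchers are in the closed
    neighbourhood of \<open>v\<close>, which is the union of the first two levels.\<close>
  have "s \<le> card (parcs G `` {v})"
    using degree_ge_3[OF v_vert] assms(5,6) by linarith
  hence sub: "pos c ` {..<s} \<subseteq> insert v (parcs G `` {v})"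
    by (rule initial_fires_degree(3)[OF c v(1)])
  have nbrs: "insert v (parcs G `` {v}) = (\<Union>j\<le>1. level j)"
    using v_vert v(2) by (auto simp: arc_iff level_def)
  \<comment> \<open>By \<open>3 \<le> n\<close> there is a level behind level 1, so its vertices
    have degree above 3.\<close>
  have no_fire: "\<not> fires k s G c u" if "u \<in> level 1" for u
    using that degree_gt_3[of u] initial_fires_degree(2)[OF c, of k u] assms(5,6)
    by (force simp: level_def)
  have occ: "u \<in> pos d ` {..<s}" if "u \<in> level 1" for u
  proof (cases "u \<in> protected c")
    case True
    then obtain i where i: "i < s" "pos c i = u"
      using c by auto
    hence "pos d i = u"
      using stage_movedD(1)[OF st i(1)] no_fire[OF that] by metis
    thus ?thesis using i(1) by auto
  next
    case False
    hence "u \<in> unprotected_nbrs G c v"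
      using that v(2) v_vert by (auto simp: unprotected_nbrs_def arc_iff level_def)
    then obtain i where "i \<in> mobile k s c v" "pos d i = u"
      using stage_firesD[OF st v(1)] by blast
    thus ?thesis by (auto simp: mobile_def)
  qed
  \<comment> \<open>A searcher that moves starts on level 0, hence gets no further than level
    1.\<close>
  have new: "pos d i \<in> (\<Union>j\<le>1. level j)" if "i < s" for i
  proof (cases "pos d i = pos c i")
    case True
    thus ?thesis using sub nbrs that by auto
  next
    case False
    have "pos c i \<notin> level 1"
      using stage_movedD(1)[OF st that False] no_fire by blast
    moreover have "pos c i \<in> (\<Union>j\<le>1. level j)"
      using sub nbrs that by auto
    ultimately have "lev (pos c i) = 0"
      by (auto simp: level_def le_Suc_eq)
    moreover have "(pos c i, pos d i) \<in> parcs G"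
      using stage_movedD(3)[OF st that False] by (simp add: unprotected_nbrs_def)
    ultimately show ?thesis
      by (auto simp: arc_iff level_def)
  qed
  have reach: "parcs G `` {v} \<subseteq> protected d"
  proof
    fix u assume u: "u \<in> parcs G `` {v}"
    show "u \<in> protected d"
    proof (cases "u \<in> protected c")
      case True
      thus ?thesis using stage_protected[OF st] by blast
    next
      case False
      hence "u \<in> unprotected_nbrs G c v"
        using u by (simp add: unprotected_nbrs_def)
      then obtain i where "i \<in> mobile k s c v" "pos d i = u"
        using stage_firesD[OF st v(1)] by blast
      thus ?thesis using stage_protected[OF st] by (auto simp: mobile_def)
    qed
  qed
  obtain i where "i \<in> mobile k s c v"
    using fires_mobile[OF v(1) finite_subset[OF unprotected_nbrs_subset finite_nbrs]] .
  hence "v \<in> protected c"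
    using c by (auto simp: mobile_def)
  with reach stage_protected[OF st] have "(\<Union>j\<le>1. level j) \<subseteq> protected d"
    unfolding nbrs[symmetric] by blast
  moreover have "protected d \<subseteq> (\<Union>j\<le>1. level j)"
    unfolding stage_protected[OF st] c using new sub[unfolded nbrs] by (simp add: image_subset_iff)
  moreover have "level 1 \<subseteq> pos d ` {..<s}"
    using occ by (rule subsetI)
  moreover have "pos d ` {..<s} \<subseteq> protected d"
    using stage_protected[OF st] by simp
  ultimately show ?thesis
    unfolding both_occupied_def covered_def by simp
qed

text \<open>If some vertex \<open>v\<close> of level 1 fires, it holds exactly two searchers, the
  third being on the other vertex. These two must take one vertex of level 2 each. If nothing fires,
  the state persists.\<close>

lemma both_occupied_stage:
  assumes c: "both_occupied s c" and st: "stage k s G c d" and "s \<le> 3" "3 \<le> n"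
  shows "both_occupied s d \<or> singly_occupied s d"
proof (cases "\<exists>v. fires k s G c v")
  case False
  have cov: "covered s 1 c"
    using c by (simp add: both_occupied_def)
  have "covered s 1 d" "\<And>i. i < s \<Longrightarrow> pos d i = pos c i"
    using covered_stage_no_fires[OF cov st] False by blast+
  thus ?thesis
    using c unfolding both_occupied_def by auto
next
  case True
  then obtain v where fv: "fires k s G c v" by blast
  let ?M = "mobile k s c v"
  have cov: "covered s 1 c" and occ: "level 1 \<subseteq> pos c ` {..<s}"
    using c by (simp_all add: both_occupied_def)
  have fire1: "w \<in> level 1" "2 \<le> card (mobile k s c w)" if "fires k s G c w" for w
    using covered_fires[OF cov that] assms(4) by simp_all
  have next2: "unprotected_nbrs G c w = level 2" if "w \<in> level 1" for w
    using covered_unprotected_nbrs[OF cov that] by (simp add: numeral_2_eq_2)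
  have v1: "v \<in> level 1"
    by (rule fire1[OF fv])
  have "card (level 1) = 2"
    using card_level[of 1] assms(4) by (simp add: level_def)
  hence "level 1 \<noteq> {v}"
    by auto
  then obtain w where w: "w \<in> level 1" "w \<noteq> v"
    using v1 by blast
  then obtain i0 where i0: "i0 < s" "pos c i0 = w"
    using occ by auto
  \<comment> \<open>The searcher \<open>i0\<close> on the other vertex leaves at most two for
    \<open>v\<close>.\<close>
  have "card (insert i0 ?M) \<le> card {..<s}"
    using i0 mobileD by (intro card_mono) (auto simp: mobile_def)
  moreover have "i0 \<notin> ?M"
    using i0 w by (auto simp: mobile_def)
  ultimately have M: "card ?M = 2"
    using fire1(2)[OF fv] finite_mobile[of k s c v] assms(3) by simp
  have only_v: "x = v" if "fires k s G c x" for x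
  proof (rule ccontr)
    assume "x \<noteq> v"
    hence "mobile k s c x \<inter> ?M = {}"
      by (auto simp: mobile_def)
    hence "card (mobile k s c x \<union> ?M) = card (mobile k s c x) + card ?M"
      using finite_mobile by (intro card_Un_disjoint)
    moreover have "card (mobile k s c x \<union> ?M) \<le> card {..<s}"
      by (intro card_mono) (auto simp: mobile_def)
    ultimately show False
      using M fire1(2)[OF that] assms(3) by simp
  qed
  have moved: "i \<in> ?M" "pos d i \<in> level 2" if "i < s" "pos d i \<noteq> pos c i" for i
    using stage_movedD[OF st that] only_v next2[OF v1] by auto
  \<comment> \<open>No searcher was on level 2 before the stage, so any searcher there has just come
    from \<open>v\<close>.\<close>
  have at2: "{i. i < s \<and> pos d i \<in> level 2} \<subseteq> ?M"
  proof
    fix i assume i: "i \<in> {i. i < s \<and> pos d i \<in> level 2}"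
    have "pos c i \<notin> level 2"
      using i cov by (auto simp: covered_def level_def)
    thus "i \<in> ?M"
      using i moved by force
  qed
  have hit: "level 2 \<subseteq> pos d ` ?M"
  proof
    fix u assume "u \<in> level 2"
    with next2[OF v1] obtain i where "i \<in> ?M" "pos d i = u"
      using stage_firesD[OF st fv] by blast
    thus "u \<in> pos d ` ?M" by blast
  qed
  have "card (level 2) = 2"
    using card_level[of 2] assms(4) by (simp add: level_def)
  moreover have "card (level 2) \<le> card (pos d ` ?M)"
    by (intro card_mono finite_imageI finite_mobile hit)
  \<comment> \<open>Two searchers cover two vertices, hence they do not share one.\<close>
  ultimately have "card (pos d ` ?M) = card ?M"
    using M card_image_le[OF finite_mobile, of "pos d" k s c v] by simp
  hence "inj_on (pos d) ?M"
    by (rule eq_card_imp_inj_on[OF finite_mobile])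
  hence inj: "inj_on (pos d) {i. i < s \<and> pos d i \<in> level 2}"
    using at2 by (rule inj_on_subset)
  have "level 2 \<subseteq> pos d ` {..<s}"
    using hit by (auto simp: mobile_def)
  moreover have "pos d ` {..<s} \<subseteq> (\<Union>j\<le>1. level j) \<union> level 2"
  proof
    fix u assume "u \<in> pos d ` {..<s}"
    then obtain i where i: "i < s" "u = pos d i"
      by auto
    have "pos c i \<in> (\<Union>j\<le>1. level j)"
      using cov i(1) unfolding covered_def by blast
    thus "u \<in> (\<Union>j\<le>1. level j) \<union> level 2"
      using moved(2)[OF i(1)] i(2) by (cases "pos d i = pos c i") auto
  qed
  moreover have "(\<Union>j\<le>2. level j) = (\<Union>j\<le>1. level j) \<union> level 2"
    by (auto simp: numeral_2_eq_2 atMost_Suc)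
  moreover have "protected d = (\<Union>j\<le>1. level j) \<union> pos d ` {..<s}"
    using cov stage_protected[OF st] by (simp add: covered_def)
  ultimately have "protected d = (\<Union>j\<le>2. level j)"
    by auto
  moreover have "pos d ` {..<s} \<subseteq> protected d"
    using stage_protected[OF st] by simp
  ultimately have "covered s 2 d"
    by (simp add: covered_def)
  with inj show ?thesis
    by (simp add: singly_occupied_def)
qed

text \<open>By \<open>4 \<le> n\<close> level 3 exists, so each vertex of level 2 has two
  unprotected neighbours but at most one searcher. Nothing fires.\<close>

lemma singly_occupied_stage:
  assumes c: "singly_occupied s c" and st: "stage k s G c d" and "4 \<le> n"
  shows "singly_occupied s d"
proof -
  have cov: "covered s 2 c" and inj: "inj_on (pos c) {i. i < s \<and> pos c i \<in> level 2}"
    using c by (simp_all add: singly_occupied_def)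
  have no_fire: "\<not> fires k s G c v" for v
  proof
    assume f: "fires k s G c v"
    have v: "v \<in> level 2" and "2 \<le> card (mobile k s c v)"
      using covered_fires[OF cov f] assms(3) by simp_all
    moreover have "inj_on (pos c) (mobile k s c v)"
      using v by (intro inj_on_subset[OF inj]) (auto simp: mobile_def)
    hence "card (mobile k s c v) = card (pos c ` mobile k s c v)"
      by (simp add: card_image)
    moreover have "card (pos c ` mobile k s c v) \<le> card {v}"
      by (intro card_mono) (auto simp: mobile_def)
    ultimately show False by simp
  qed
  have "covered s 2 d" and eq: "\<And>i. i < s \<Longrightarrow> pos d i = pos c i"
    using covered_stage_no_fires[OF cov st no_fire] by blast+
  moreover have "inj_on (pos d) {i. i < s \<and> pos d i \<in> level 2}"
    using inj eq by (auto simp: inj_on_def)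
  ultimately show ?thesis
    by (simp add: singly_occupied_def)
qed

lemma covered_not_all:
  assumes "covered s l c" "Suc l < n"
  shows "\<not> pverts G \<subseteq> protected c"
proof -
  have "card (level (Suc l)) = 2"
    using card_level[OF assms(2)] by (simp add: level_def)
  hence "level (Suc l) \<noteq> {}" by auto
  thus ?thesis
    using assms(1) by (auto simp: covered_def level_def)
qed

text \<open>With fewer than three searchers no vertex can fire, as all degrees are at least 3. The
  protected vertices remain the occupied ones, too few to be all.\<close>

lemma successful_layout_ge_3:
  assumes "2 \<le> n" "successful_layout k G s L"
  shows "3 \<le> s"
proof (rule ccontr)
  assume s: "\<not> 3 \<le> s"
  obtain d where d: "(stage k s G)\<^sup>*\<^sup>* (initial_config s L) d" "pverts G \<subseteq> protected d"
    using assms(2) by (auto simp: successful_layout_def)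
  from d(1) have "protected d = pos d ` {..<s}"
  proof (induction rule: rtranclp_induct)
    case base
    show ?case by (simp add: initial_config_def)
  next
    case (step c d)
    have "\<not> fires k s G c v" for v
      using initial_fires_degree(1,2)[OF step.IH, of k v] degree_ge_3[of v] assms(1) s by force
    thus ?case
      using stage_no_fires[OF step.hyps(2)] step.IH by auto
  qed
  thus False
    using card_initial[of d s] d(2) assms(1) s by simp
qed

end

section \<open>The strong grid with two rows\<close>

abbreviation grid2 :: "nat \<Rightarrow> (nat \<times> nat) pair_pre_digraph" where
  "grid2 n \<equiv> path_graph 2 \<boxtimes> path_graph n"

lemma strip_grid2: "strip (grid2 n) snd n"
proof
  show "(u, v) \<in> parcs (grid2 n) \<longleftrightarrow> u \<in> pverts (grid2 n) \<and> v \<in> pverts (grid2 n) \<and> u \<noteq> v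
      \<and> snd u \<le> Suc (snd v) \<and> snd v \<le> Suc (snd u)" for u v
    by (cases u; cases v) (auto simp: parcs_strong_grid pverts_strong_grid)
next
  fix j assume "j < n"
  hence "{v \<in> pverts (grid2 n). snd v = j} = {..<2} \<times> {j}"
    by (auto simp: pverts_strong_grid)
  thus "card {v \<in> pverts (grid2 n). snd v = j} = 2"
    by simp
qed (auto simp: pverts_strong_grid)

text \<open>Counting from the other end gives the last column level 0; \<open>Suc\<close> corrects
  for column indices starting at 0.\<close>

lemma strip_grid2_reflected: "strip (grid2 n) (\<lambda>v. n - Suc (snd v)) n"
proof
  show "(u, v) \<in> parcs (grid2 n) \<longleftrightarrow> u \<in> pverts (grid2 n) \<and> v \<in> pverts (grid2 n) \<and> u \<noteq> v
      \<and> n - Suc (snd u) \<le> Suc (n - Suc (snd v)) \<and> n - Suc (snd v) \<le> Suc (n - Suc (snd u))" for u v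
    by (cases u; cases v) (auto simp: parcs_strong_grid pverts_strong_grid)
next
  fix j assume "j < n"
  hence "{v \<in> pverts (grid2 n). n - Suc (snd v) = j} = {..<2} \<times> {n - Suc j}"
    by (auto simp: pverts_strong_grid)
  thus "card {v \<in> pverts (grid2 n). n - Suc (snd v) = j} = 2"
    by simp
qed (auto simp: pverts_strong_grid)

lemma finite_unprotected_nbrs_grid2: "finite (unprotected_nbrs (grid2 n) c v)"
  by (rule finite_subset[OF unprotected_nbrs_subset strip.finite_nbrs[OF strip_grid2]])

section \<open>Lower bound for four or more columns\<close>

lemma successful_layout_grid2_ge_4:
  assumes "4 \<le> n" "successful_layout k (grid2 n) s L"
  shows "4 \<le> s"
proof (rule ccontr)
  assume "\<not> 4 \<le> s"
  hence s: "s \<le> 3" by simp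
  let ?G = "grid2 n"
  interpret A: strip ?G snd n by (rule strip_grid2)
  interpret B: strip ?G "\<lambda>v. n - Suc (snd v)" n by (rule strip_grid2_reflected)
  obtain d where d: "(stage k s ?G)\<^sup>*\<^sup>* (initial_config s L) d" "pverts ?G \<subseteq> protected d"
    using assms(2) by (auto simp: successful_layout_def)
  \<comment> \<open>The invariant: nothing has fired yet, or the sweep from the left
    (\<open>A\<close>) or from the right (\<open>B\<close>) has reached level 1 or is stuck at level
    2.\<close>
  from d(1) have "protected d = pos d ` {..<s} \<or> A.both_occupied s d \<or> A.singly_occupied s d
      \<or> B.both_occupied s d \<or> B.singly_occupied s d"
  proof (induction rule: rtranclp_induct)
    case base
    show ?case by (simp add: initial_config_def)
  next
    case (step c d)
    show ?case
    proof (cases "protected c = pos c ` {..<s}")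
      case init: True
      show ?thesis
      proof (cases "\<exists>v. fires k s ?G c v")
        case True
        then obtain v where v: "fires k s ?G c v" by blast
        \<comment> \<open>Inner vertices have degree above 3, so the first vertex to fire lies in an
          end column.\<close>
        have "\<not> (0 < snd v \<and> Suc (snd v) < n)"
          using A.initial_fires_degree(1,2)[OF init v] A.degree_gt_3[of v] s by linarith
        moreover have "snd v < n"
          using v A.lev_less by (simp add: fires_def)
        ultimately have "snd v = 0 \<or> n - Suc (snd v) = 0"
          by linarith
        thus ?thesis
          using A.initial_stage[OF init step.hyps(2) v] B.initial_stage[OF init step.hyps(2) v]
            s assms(1) by auto
      next
        case False
        thus ?thesis
          using stage_no_fires[OF step.hyps(2)] init by auto
      qed
    next
      case False
      have "3 \<le> n" using assms(1) by simp
      with False step.IH show ?thesis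
        using A.both_occupied_stage[OF _ step.hyps(2) s] A.singly_occupied_stage[OF _ step.hyps(2)]
          B.both_occupied_stage[OF _ step.hyps(2) s] B.singly_occupied_stage[OF _ step.hyps(2)]
          assms(1) by blast
    qed
  qed
  \<comment> \<open>No state of the invariant is final: three searchers cannot occupy all vertices,
    and level 3 is unprotected in the covered states.\<close>
  moreover have "protected d \<noteq> pos d ` {..<s}"
    using A.card_initial[of d s] d(2) s assms(1) by auto
  moreover have "\<not> A.covered s l d \<and> \<not> B.covered s l d" if "l \<le> 2" for l
    using A.covered_not_all[of s l d] B.covered_not_all[of s l d] that d(2) assms(1) by auto
  ultimately show False
    unfolding A.both_occupied_def B.both_occupied_def A.singly_occupied_def B.singly_occupied_def
    by force
qed

section \<open>Strategies for the upper bounds\<close>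

lemma successful_layout_grid2_4:
  assumes "0 < n" "n \<le> k + 1"
  shows "\<exists>L. successful_layout k (grid2 n) 4 L"
proof -
  let ?G = "grid2 n"
  \<comment> \<open>The two searchers on a vertex must separate at each stage, so the pairs \<open>{0, 1}, {2, 3}\<close> and
    \<open>{0, 2}, {1, 3}\<close> alternate.\<close>
  define p where "p j i = ((if even j then i div 2 else i mod 2), j)" for j i :: nat
  \<comment> \<open>This is the game after \<open>j\<close> stages, each searcher having moved
    \<open>j\<close> times. The last column takes \<open>n - 1\<close> stages, which
    \<open>n \<le> k + 1\<close> allows.\<close>
  define c where "c j = \<lparr>pos = p j, moves = (\<lambda>_. j), protected = {..<2} \<times> {..j}\<rparr>" for j
  have four: "{..<4::nat} = {0, 1, 2, 3}" and two: "{..<2::nat} = {0, 1}"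
    by auto
  have img: "p j ` {..<4} = {..<2} \<times> {j}" for j
    by (auto simp: p_def four two)
  have nbrs: "unprotected_nbrs ?G (c j) (r, j) = {..<2} \<times> {Suc j}" if "r < 2" "Suc j < n" for r j
    using that by (auto simp: unprotected_nbrs_def c_def parcs_strong_grid)
  \<comment> \<open>Searcher \<open>2 * a + b\<close> has quotient \<open>a\<close> and remainder
    \<open>b\<close>, so every pair of a current and a next row belongs to some searcher.\<close>
  have split: "\<exists>i<4. p j i = (r, j) \<and> p (Suc j) i = (r', Suc j)" if "r < 2" "r' < 2" for j r r'
  proof -
    have "\<exists>i<4. i div 2 = a \<and> i mod 2 = b" if "a < 2" "b < 2" for a b :: nat
      using that by (intro exI[of _ "2 * a + b"]) auto
    thus ?thesis
      using that by (cases "even j") (auto simp: p_def)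
  qed
  have mobile: "\<exists>i\<in>mobile k 4 (c j) (r, j). p (Suc j) i = u"
    if "r < 2" "Suc j < n" "u \<in> {..<2} \<times> {Suc j}" for r j u
    using split[of r "fst u" j] that assms(2) by (auto simp: mobile_def c_def)
  have fires: "fires k 4 ?G (c j) (r, j)" if "r < 2" "Suc j < n" for r j
  proof -
    \<comment> \<open>A map from the mobile searchers onto the targets shows that there are enough
      of them.\<close>
    have "unprotected_nbrs ?G (c j) (r, j) \<subseteq> p (Suc j) ` mobile k 4 (c j) (r, j)"
    proof
      fix u assume "u \<in> unprotected_nbrs ?G (c j) (r, j)"
      hence "\<exists>i\<in>mobile k 4 (c j) (r, j). p (Suc j) i = u"
        using mobile[OF that] nbrs[OF that] by simp
      thus "u \<in> p (Suc j) ` mobile k 4 (c j) (r, j)" by blast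
    qed
    hence "card (unprotected_nbrs ?G (c j) (r, j)) \<le> card (mobile k 4 (c j) (r, j))"
      by (rule surj_card_le[OF finite_mobile])
    thus ?thesis
      using nbrs[OF that] that unfolding fires_def by (auto simp: pverts_strong_grid)
  qed
  have p_in: "p j i \<in> {..<2} \<times> {j}" if "i < 4" for i j
    using img[of j] that by blast
  have "stage k 4 ?G (c j) (c (Suc j))" if j: "Suc j < n" for j
    unfolding c_def[of "Suc j"]
  proof (rule stageI)
    fix v u assume v: "fires k 4 ?G (c j) v" "u \<in> unprotected_nbrs ?G (c j) v"
    obtain i where "i \<in> mobile k 4 (c j) v"
      using fires_mobile[OF v(1) finite_unprotected_nbrs_grid2] .
    hence "v \<in> {..<2} \<times> {j}"
      using p_in by (auto simp: mobile_def c_def)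
    thus "\<exists>i\<in>mobile k 4 (c j) v. p (Suc j) i = u"
      using v(2) mobile nbrs j by auto
  next
    fix i :: nat assume "i < 4"
    hence "p j i \<in> {..<2} \<times> {j}" "p (Suc j) i \<in> {..<2} \<times> {Suc j}"
      using p_in by blast+
    thus "fires k 4 ?G (c j) (pos (c j) i) \<and> moves (c j) i < k
           \<and> p (Suc j) i \<in> unprotected_nbrs ?G (c j) (pos (c j) i)"
      using fires[OF _ j] nbrs[OF _ j] j assms(2) by (auto simp: c_def)
  next
    show "{..<2} \<times> {..Suc j} = protected (c j) \<union> p (Suc j) ` {..<4}"
      by (auto simp: img c_def)
  qed (auto simp: c_def p_def)
  hence "(stage k 4 ?G)\<^sup>*\<^sup>* (c 0) (c j)" if "j < n" for j
    using that by (induction j) (auto intro: rtranclp.rtrancl_into_rtrancl)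
  hence "(stage k 4 ?G)\<^sup>*\<^sup>* (c 0) (c (n - 1))"
    using assms(1) by simp
  moreover have "c 0 = initial_config 4 (p 0)"
    unfolding c_def initial_config_def img by auto
  moreover have "pverts ?G \<subseteq> protected (c (n - 1))"
    by (auto simp: pverts_strong_grid c_def)
  moreover have "is_layout ?G 4 (p 0)"
    using assms(1) unfolding is_layout_def img by (auto simp: pverts_strong_grid)
  ultimately show ?thesis
    unfolding successful_layout_def by metis
qed

text \<open>The grid is a complete graph on four vertices, so three searchers on one vertex reach
  the others in one stage.\<close>

lemma successful_layout_grid2_2:
  assumes "0 < k"
  shows "\<exists>L. successful_layout k (grid2 2) 3 L"
proof -
  let ?G = "grid2 2"
  define L :: "nat \<Rightarrow> nat \<times> nat" where "L = (\<lambda>_. (0, 0))"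
  define c where "c = initial_config 3 L"
  \<comment> \<open>The coordinates are the binary digits of \<open>Suc i\<close>, which runs
    through 1, 2, 3.\<close>
  define p :: "nat \<Rightarrow> nat \<times> nat" where "p i = (Suc i div 2, Suc i mod 2)" for i
  have three: "{..<3::nat} = {0, 1, 2}" and two: "{..<2::nat} = {0, 1}"
    by auto
  have nbrs: "unprotected_nbrs ?G c (0, 0) = {(0, 1), (1, 0), (1, 1)}"
    by (auto simp: unprotected_nbrs_def c_def initial_config_def L_def three parcs_strong_grid)
  have mobile: "mobile k 3 c v = (if v = (0, 0) then {0, 1, 2} else {})" for v
    using assms by (auto simp: mobile_def c_def initial_config_def L_def)
  have fires: "fires k 3 ?G c v \<longleftrightarrow> v = (0, 0)" for v
  proof
    assume "fires k 3 ?G c v"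
    from fires_mobile[OF this finite_unprotected_nbrs_grid2]
    obtain i where "i \<in> mobile k 3 c v" .
    thus "v = (0, 0)" using mobile by (auto split: if_splits)
  qed (simp add: fires_def nbrs mobile pverts_strong_grid)
  have "stage k 3 ?G c \<lparr>pos = p, moves = (\<lambda>_. 1), protected = {..<2} \<times> {..<2}\<rparr>"
  proof (rule stageI)
    show "{..<2} \<times> {..<2} = protected c \<union> p ` {..<3}"
      by (auto simp: c_def initial_config_def L_def p_def three two)
  next
    fix i :: nat assume "i < 3"
    hence "i = 0 \<or> i = 1 \<or> i = 2" by auto
    hence p_i: "p i \<in> {(0, 1), (1, 0), (1, 1)}"
      by (auto simp: p_def)
    thus "fires k 3 ?G c (pos c i) \<and> moves c i < k \<and> p i \<in> unprotected_nbrs ?G c (pos c i)"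
      using assms nbrs fires by (simp add: c_def initial_config_def L_def)
    show "1 = (if p i = pos c i then moves c i else Suc (moves c i))"
      using p_i by (auto simp: c_def initial_config_def L_def)
  qed (auto simp: fires nbrs mobile p_def)
  hence "(stage k 3 ?G)\<^sup>*\<^sup>* (initial_config 3 L)
      \<lparr>pos = p, moves = (\<lambda>_. 1), protected = {..<2} \<times> {..<2}\<rparr>"
    unfolding c_def by (rule r_into_rtranclp)
  thus ?thesis
    unfolding successful_layout_def is_layout_def
    by (intro exI conjI, goal_cases) (auto simp: L_def pverts_strong_grid)
qed

text \<open>Searchers 0 and 1 start in the corners, where only \<open>(0, 1)\<close> is unprotected.
  They meet there and then part into the last column, using two moves each; searcher 2 on
  \<open>(1, 1)\<close> never moves.\<close>

lemma successful_layout_grid2_3: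
  assumes "2 \<le> k"
  shows "\<exists>L. successful_layout k (grid2 3) 3 L"
proof -
  let ?G = "grid2 3"
  define L :: "nat \<Rightarrow> nat \<times> nat" where
    "L i = (if i = 0 then (0, 0) else if i = 1 then (1, 0) else (1, 1))" for i
  define p :: "nat \<Rightarrow> nat \<times> nat" where "p i = (if i = 2 then (1, 1) else (0, 1))" for i
  define q :: "nat \<Rightarrow> nat \<times> nat" where "q i = (if i = 2 then (1, 1) else (i, 2))" for i
  define c where "c = initial_config 3 L"
  define d where "d = \<lparr>pos = p, moves = (\<lambda>i. if i = 2 then 0 else 1), protected = {..<2} \<times> {..<2}\<rparr>"
  define e where "e = \<lparr>pos = q, moves = (\<lambda>i. if i = 2 then 0 else 2), protected = {..<2} \<times> {..<3}\<rparr>"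
  have three: "{..<3::nat} = {0, 1, 2}" and two: "{..<2::nat} = {0, 1}"
    by auto
  have less_3: "i < 3 \<Longrightarrow> i = 0 \<or> i = 1 \<or> i = 2" for i :: nat
    by auto

  have nbrs: "unprotected_nbrs ?G c (r, 0) = {(0, 1)}" if "r < 2" for r
    using that by (auto simp: unprotected_nbrs_def c_def initial_config_def L_def three parcs_strong_grid)
  \<comment> \<open>Three unprotected neighbours already keep the single searcher on
    \<open>(1, 1)\<close> from firing.\<close>
  have nbrs': "{(0, 1), (0, 2), (1, 2)} \<subseteq> unprotected_nbrs ?G c (1, 1)"
    by (auto simp: unprotected_nbrs_def c_def initial_config_def L_def three parcs_strong_grid)
  have mobile: "mobile k 3 c (0, 0) = {0}" "mobile k 3 c (1, 0) = {1}" "mobile k 3 c (1, 1) = {2}"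
    "v \<notin> {(0, 0), (1, 0), (1, 1)} \<Longrightarrow> mobile k 3 c v = {}" for v
    using assms by (auto simp: mobile_def c_def initial_config_def L_def)
  have fires: "fires k 3 ?G c v \<longleftrightarrow> v = (0, 0) \<or> v = (1, 0)" for v
  proof
    assume f: "fires k 3 ?G c v"
    from fires_mobile[OF this finite_unprotected_nbrs_grid2]
    have "v \<in> {(0, 0), (1, 0), (1, 1)}"
      using mobile(4) by blast
    moreover have "card {(0, 1), (0, 2), (1, 2) :: nat \<times> nat} \<le> card (unprotected_nbrs ?G c (1, 1))"
      by (rule card_mono[OF finite_unprotected_nbrs_grid2 nbrs'])
    hence "v \<noteq> (1, 1)"
      using f mobile(3) by (auto simp: fires_def)
    ultimately show "v = (0, 0) \<or> v = (1, 0)" by blast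
  qed (use nbrs mobile in \<open>auto simp: fires_def pverts_strong_grid\<close>)
  have stage1: "stage k 3 ?G c d"
    unfolding d_def
  proof (rule stageI)
    show "{..<2} \<times> {..<2} = protected c \<union> p ` {..<3}"
      by (auto simp: c_def initial_config_def L_def p_def three two)
  next
    fix v u assume "fires k 3 ?G c v" "u \<in> unprotected_nbrs ?G c v"
    thus "\<exists>i\<in>mobile k 3 c v. p i = u"
      using fires nbrs mobile by (auto simp: p_def)
  next
    fix i :: nat assume i: "i < 3"
    show "p i \<noteq> pos c i \<Longrightarrow>
        fires k 3 ?G c (pos c i) \<and> moves c i < k \<and> p i \<in> unprotected_nbrs ?G c (pos c i)"
      using assms nbrs fires less_3[OF i] by (auto simp: c_def initial_config_def L_def p_def)
    show "(if i = 2 then 0 else 1) = (if p i = pos c i then moves c i else Suc (moves c i))"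
      using less_3[OF i] by (auto simp: c_def initial_config_def L_def p_def)
  qed

  have nbrs2: "unprotected_nbrs ?G d (r, 1) = {(0, 2), (1, 2)}" if "r < 2" for r
    using that by (auto simp: unprotected_nbrs_def d_def parcs_strong_grid)
  have mobile2: "mobile k 3 d (0, 1) = {0, 1}" "mobile k 3 d (1, 1) = {2}"
    "v \<notin> {(0, 1), (1, 1)} \<Longrightarrow> mobile k 3 d v = {}" for v
    using assms by (auto simp: mobile_def d_def p_def)
  have fires2: "fires k 3 ?G d v \<longleftrightarrow> v = (0, 1)" for v
  proof
    assume f: "fires k 3 ?G d v"
    from fires_mobile[OF this finite_unprotected_nbrs_grid2]
    have "v \<in> {(0, 1), (1, 1)}"
      using mobile2(3) by blast
    \<comment> \<open>The single searcher still faces both vertices of the last column.\<close>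
    moreover have "v \<noteq> (1, 1)"
      using f mobile2(2) nbrs2 by (auto simp: fires_def)
    ultimately show "v = (0, 1)" by blast
  qed (use nbrs2 mobile2 in \<open>auto simp: fires_def pverts_strong_grid\<close>)
  have stage2: "stage k 3 ?G d e"
    unfolding e_def
  proof (rule stageI)
    show "{..<2} \<times> {..<3} = protected d \<union> q ` {..<3}"
      by (auto simp: d_def q_def three two)
  next
    fix v u assume "fires k 3 ?G d v" "u \<in> unprotected_nbrs ?G d v"
    thus "\<exists>i\<in>mobile k 3 d v. q i = u"
      using fires2 nbrs2 mobile2 by (auto simp: q_def)
  next
    fix i :: nat assume i: "i < 3"
    show "q i \<noteq> pos d i \<Longrightarrow>
        fires k 3 ?G d (pos d i) \<and> moves d i < k \<and> q i \<in> unprotected_nbrs ?G d (pos d i)"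
      using assms nbrs2 fires2 less_3[OF i] by (auto simp: d_def p_def q_def)
    show "(if i = 2 then 0 else 2) = (if q i = pos d i then moves d i else Suc (moves d i))"
      using less_3[OF i] by (auto simp: d_def p_def q_def)
  qed

  have "(stage k 3 ?G)\<^sup>*\<^sup>* (initial_config 3 L) e"
    using stage1 stage2 unfolding c_def by (meson rtranclp.rtrancl_into_rtrancl r_into_rtranclp)
  moreover have "pverts ?G \<subseteq> protected e"
    by (auto simp: pverts_strong_grid e_def)
  moreover have "is_layout ?G 3 L"
    by (auto simp: is_layout_def L_def pverts_strong_grid)
  ultimately show ?thesis
    unfolding successful_layout_def by blast
qed

theorem theorem5p3:
  fixes k n :: nat
  assumes "k \<ge> 2"
  shows "(2 \<le> n \<and> n \<le> 3 \<longrightarrow> deduction_number k (path_graph 2 \<boxtimes> path_graph n) = 3) \<and>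
         (4 \<le> n \<and> n \<le> k + 1 \<longrightarrow> deduction_number k (path_graph 2 \<boxtimes> path_graph n) = 4)"
proof (intro conjI impI)
  assume n: "2 \<le> n \<and> n \<le> 3"
  hence "n = 2 \<or> n = 3" by auto
  hence "\<exists>L. successful_layout k (grid2 n) 3 L"
    using successful_layout_grid2_2 successful_layout_grid2_3 assms by auto
  thus "deduction_number k (grid2 n) = 3"
    unfolding deduction_number_def
    using strip.successful_layout_ge_3[OF strip_grid2] n by (intro Least_equality) blast+
next
  assume n: "4 \<le> n \<and> n \<le> k + 1"
  hence "\<exists>L. successful_layout k (grid2 n) 4 L"
    using successful_layout_grid2_4[of n k] by simp
  thus "deduction_number k (grid2 n) = 4"
    unfolding deduction_number_def
    using successful_layout_grid2_ge_4 n by (intro Least_equality) blast+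
qed

end
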